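(* Let $(X,d)$ be a geometrically doubling metric space, let $0<\delta\le 1/1000$ and $\gamma\in(0,1/2]$ be given by $\gamma=\frac{\alpha}{2(\alpha+\log_2 C_\lambda)}$, where $\alpha>0$ and $C_\lambda\ge1$. Let $\mathcal{D}$ be a fixed dyadic system, and let $\mathcal{D}'$ be a randomly chosen dyadic system. There is an exponent $\eta>0$, independent of $r$ and of the cube below, such that for every fixed cube $Q\in\mathcal{D}$, $$\mathbb{P}(Q\in\mathcal{D}_{\mathrm{bad}})\le G\,\delta^{r\gamma\eta},$$ where the constant $G$ does not depend on $Q$ or $r$. Moreover $\eta$ can be taken to be an exponent with the property that $\mathbb{P}\big(x\in\delta_{R}\text{ for some cube }R\in\mathcal{D}'\text{ of generation }k\big)\le G'\epsilon^\eta$ for all $x\in X$, $k\in\mathbb{Z}$, $\epsilon>0$, where $\delta_R=\{x: d(x,R)\le\epsilon\ell(R),\ d(x,X\setminus R)\le\epsilon\ell(R)\}$.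
   Context: Geometrically doubling: every ball of radius $r$ can be covered by at most $N$ balls of radius $r/2$. Convention: the distance to the empty set is $+\infty$. ($\alpha$ is the H\"older exponent of a standard kernel and $C_\lambda$ the doubling constant of the dominating function of an upper doubling measure on $X$; only the value of $\gamma$ matters here.) Dyadic systems. For each $k\in\mathbb{Z}$ let $(x^k_\sigma)_\sigma$ be points with $d(x^k_\sigma,x^k_\tau)\ge\delta^k/8$ for $\sigma\ne\tau$ and $\min_\sigma d(x,x^k_\sigma)<4\delta^k$ for all $x\in X$. Each pair $(k,\sigma)$ is assigned exactly one parent $(k-1,\tau)$: if there is $\tau$ with $d(x^k_\sigma,x^{k-1}_\tau)<\delta^{k-1}/16$ (there is at most one) take it; otherwise choose some $\tau$ with $d(x^k_\sigma,x^{k-1}_\tau)<4\delta^{k-1}$. Let $\le'$ be the reflexive transitive relation generated by $(k,\sigma)\le'$ its parent. Put $P^k_\sigma=\bigcup_{(\ell,\tau)\le'(k,\sigma)}B(x^\ell_\tau,\delta^\ell/100)$ and $\tilde P^k_\sigma=X\setminus\bigcup_{\tau\ne\sigma}\overline{P^k_\tau}$. A dyadic system is a family of Borel sets $Q^k_\sigma$ ("half-open cubes") with $\tilde P^k_\sigma\subset Q^k_\sigma\subset\overline{P^k_\sigma}$, such that for each $k$ the sets $Q^k_\sigma$ partition $X$, for $\ell\ge k$ either $Q^\ell_\tau\subset Q^k_\sigma$ or $Q^\ell_\tau\cap Q^k_\sigma=\emptyset$, and $Q^k_\sigma=\bigcup_{\tau:(\ell,\tau)\le'(k,\sigma)}Q^\ell_\tau$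 for $\ell\ge k$ (such families exist). For $Q=Q^k_\sigma$ write $\ell(Q)=\delta^k$; $k$ is its generation. Random dyadic system. For each $k$ fix a maximal collection $(z^k_\sigma)_\sigma$ in $X$ with $d(z^k_\sigma,z^k_\tau)\ge\delta^k$ for $\sigma\neq\tau$. Each $(k,\sigma)$ gets one parent $(k-1,\tau)$: the unique $\tau$ with $d(z^k_\sigma,z^{k-1}_\tau)<\delta^{k-1}/2$ if it exists, otherwise some $\tau$ with $d(z^k_\sigma,z^{k-1}_\tau)<\delta^{k-1}$; let $\le$ be the generated relation. For each $(k,\sigma)$ choose at random, uniformly among all $\tau$ with $(k+1,\tau)\le(k,\sigma)$ and independently for different pairs $(k,\sigma)$, one $\tau$, and set $y^k_\sigma=z^{k+1}_\tau$. Points $y^k_\sigma,y^k_\tau$ conflict if $d(y^k_\sigma,y^k_\tau)<\delta^k/4$. For each $k$, enumerate the points as $y^k_1,y^k_2,\dots$; keep $y^k_1$ and remove all points conflicting with it, then keep the remaining point of smallest index and remove all points conflicting with it, and so on. The remaining points are the $x^k_\sigma$; they satisfy $d(x^k_\sigma,x^k_\tau)\ge\delta^k/4$ and every $x\in X$ has some $x^k_\sigma$ with $d(x,x^k_\sigma)<3\delta^k$. The random system is the dyadic system built from these points (with any choices of parents in $\le'$ made by a fixed rule depending only on the centres of the two generations involved). Good and bad cubes. Let $r\ge1$ be a fixed integer. $Q\in\mathcal{D}$ is good if for every $R\in\mathcal{D}'$ with $\ell(Q)\le\delta^r\ell(R)$ one has $d(Q,R)\ge\ell(Q)^\gamma\ell(R)^{1-\gamma}$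 or $d(Q,X\setminus R)\ge\ell(Q)^\gamma\ell(R)^{1-\gamma}$. The set of cubes $Q \in \mathcal{D}$ that are not good is $\mathcal{D}_{\mathrm{bad}}$. *)

theory Defs
  imports "HOL-Probability.Probability"
begin

definition geometrically_doubling :: "'a::metric_space itself \<Rightarrow> bool" where
  "geometrically_doubling _ \<longleftrightarrow>
     (\<exists>N::nat. \<forall>(x::'a) r. 0 < r \<longrightarrow>
        (\<exists>A. finite A \<and> card A \<le> N \<and> ball x r \<subseteq> (\<Union>a\<in>A. ball a (r / 2))))"

text \<open>The distance of two sets with values in \<^typ>\<open>ennreal\<close>, so that the distance to the empty
  set is infinite (the library's \<^const>\<open>infdist\<close> and \<^const>\<open>setdist\<close> return 0 there).\<close>

definition eset_dist :: "'a::metric_space set \<Rightarrow> 'a set \<Rightarrow> ennreal" where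
  "eset_dist A B = (INF a\<in>A. INF b\<in>B. ennreal (dist a b))"

definition separated :: "real \<Rightarrow> 'a::metric_space set \<Rightarrow> bool" where
  "separated s A \<longleftrightarrow> (\<forall>p\<in>A. \<forall>q\<in>A. p \<noteq> q \<longrightarrow> s \<le> dist p q)"

definition maximal_separated :: "real \<Rightarrow> 'a::metric_space set \<Rightarrow> bool" where
  "maximal_separated s A \<longleftrightarrow> separated s A \<and> (\<forall>B. separated s B \<and> A \<subseteq> B \<longrightarrow> B = A)"

text \<open>A family of points of generation \<open>k\<close> is injective by separation, so it is given by the set
  \<open>C k\<close> of its points, and a point serves as its own index: the pair \<open>(k, \<sigma>)\<close> is \<open>(k, p)\<close> with
  \<open>p \<in> C k\<close>.  The parent of \<open>(k, p)\<close> is \<open>(k - 1, par k p)\<close>.  In both parent rules a parent is sought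
  first within \<open>a * \<delta>^(k-1)\<close> and then within \<open>b * \<delta>^(k-1)\<close>.\<close>

definition parent_map ::
    "real \<Rightarrow> real \<Rightarrow> real \<Rightarrow> (int \<Rightarrow> 'a::metric_space set) \<Rightarrow> (int \<Rightarrow> 'a \<Rightarrow> 'a) \<Rightarrow> bool" where
  "parent_map a b \<delta> C par \<longleftrightarrow>
     (\<forall>k. \<forall>p\<in>C k. par k p \<in> C (k - 1) \<and>
        (if \<exists>q\<in>C (k - 1). dist p q < a * \<delta> powi (k - 1)
         then dist p (par k p) < a * \<delta> powi (k - 1)
         else dist p (par k p) < b * \<delta> powi (k - 1)))"

definition descends ::
    "(int \<Rightarrow> 'a set) \<Rightarrow> (int \<Rightarrow> 'a \<Rightarrow> 'a) \<Rightarrow> ((int \<times> 'a) \<times> (int \<times> 'a)) set" where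
  "descends C par = {((k, p), (k - 1, par k p)) | k p. p \<in> C k}\<^sup>*"

definition dyadic_open ::
    "real \<Rightarrow> (int \<Rightarrow> 'a::metric_space set) \<Rightarrow> (int \<Rightarrow> 'a \<Rightarrow> 'a) \<Rightarrow> int \<Rightarrow> 'a \<Rightarrow> 'a set" where
  "dyadic_open \<delta> C par k p =
     (\<Union>(l, q) \<in> {i. (i, (k, p)) \<in> descends C par}. ball q (\<delta> powi l / 100))"

definition dyadic_inner ::
    "real \<Rightarrow> (int \<Rightarrow> 'a::metric_space set) \<Rightarrow> (int \<Rightarrow> 'a \<Rightarrow> 'a) \<Rightarrow> int \<Rightarrow> 'a \<Rightarrow> 'a set" where
  "dyadic_inner \<delta> C par k p = - (\<Union>q\<in>C k - {p}. closure (dyadic_open \<delta> C par k q))"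

definition dyadic_centres :: "real \<Rightarrow> (int \<Rightarrow> 'a::metric_space set) \<Rightarrow> bool" where
  "dyadic_centres \<delta> C \<longleftrightarrow>
     (\<forall>k. separated (\<delta> powi k / 8) (C k) \<and> (\<forall>x. \<exists>p\<in>C k. dist x p < 4 * \<delta> powi k))"

text \<open>\<open>Q k p\<close> for \<open>p \<in> C k\<close> are the cubes of generation \<open>k\<close>.  A cube is handled as the pair \<open>(k, p)\<close>,
  because the same set may occur in several generations.\<close>

definition dyadic_system ::
    "real \<Rightarrow> (int \<Rightarrow> 'a::metric_space set) \<Rightarrow> (int \<Rightarrow> 'a \<Rightarrow> 'a) \<Rightarrow> (int \<Rightarrow> 'a \<Rightarrow> 'a set) \<Rightarrow> bool" where
  "dyadic_system \<delta> C par Q \<longleftrightarrow>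
     dyadic_centres \<delta> C \<and>
     parent_map (1 / 16) 4 \<delta> C par \<and>
     (\<forall>k. \<forall>p\<in>C k. Q k p \<in> sets borel \<and>
        dyadic_inner \<delta> C par k p \<subseteq> Q k p \<and> Q k p \<subseteq> closure (dyadic_open \<delta> C par k p)) \<and>
     (\<forall>k. disjoint_family_on (Q k) (C k) \<and> (\<Union>p\<in>C k. Q k p) = UNIV) \<and>
     (\<forall>k l. k \<le> l \<longrightarrow> (\<forall>p\<in>C k. \<forall>q\<in>C l. Q l q \<subseteq> Q k p \<or> Q l q \<inter> Q k p = {})) \<and>
     (\<forall>k l. k \<le> l \<longrightarrow> (\<forall>p\<in>C k. Q k p = (\<Union>q\<in>{q. ((l, q), (k, p)) \<in> descends C par}. Q l q)))"

text \<open>Greedy thinning of a set \<open>S\<close> enumerated by an injective \<open>idx\<close> (gaps in the numbering are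
  harmless): \<open>thinned_below idx s S n\<close> are the points of index less than \<open>n\<close> that are kept.\<close>

primrec thinned_below :: "('a::metric_space \<Rightarrow> nat) \<Rightarrow> real \<Rightarrow> 'a set \<Rightarrow> nat \<Rightarrow> 'a set" where
  "thinned_below idx s S 0 = {}"
| "thinned_below idx s S (Suc n) = thinned_below idx s S n \<union>
     {p \<in> S. idx p = n \<and> (\<forall>q\<in>thinned_below idx s S n. \<not> dist p q < s)}"

definition thinned :: "('a::metric_space \<Rightarrow> nat) \<Rightarrow> real \<Rightarrow> 'a set \<Rightarrow> 'a set" where
  "thinned idx s S = (\<Union>n. thinned_below idx s S n)"

definition children :: "(int \<Rightarrow> 'a set) \<Rightarrow> (int \<Rightarrow> 'a \<Rightarrow> 'a) \<Rightarrow> int \<Rightarrow> 'a \<Rightarrow> 'a set" where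
  "children Z zpar k p = {q. ((k + 1, q), (k, p)) \<in> descends Z zpar}"

definition random_points :: "(int \<Rightarrow> 'a set) \<Rightarrow> (int \<Rightarrow> 'a \<Rightarrow> 'w \<Rightarrow> 'a) \<Rightarrow> 'w \<Rightarrow> int \<Rightarrow> 'a set" where
  "random_points Z y \<omega> k = (\<lambda>p. y k p \<omega>) ` Z k"

definition random_centres ::
    "real \<Rightarrow> (int \<Rightarrow> 'a::metric_space set) \<Rightarrow> (int \<Rightarrow> 'a \<Rightarrow> 'w \<Rightarrow> 'a) \<Rightarrow>
     (int \<Rightarrow> 'a set \<Rightarrow> 'a \<Rightarrow> nat) \<Rightarrow> 'w \<Rightarrow> int \<Rightarrow> 'a set" where
  "random_centres \<delta> Z y idx \<omega> k =
     thinned (idx k (random_points Z y \<omega> k)) (\<delta> powi k / 4) (random_points Z y \<omega> k)"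

definition rule_parents ::
    "(int \<Rightarrow> 'a set \<Rightarrow> 'a set \<Rightarrow> 'a \<Rightarrow> 'a) \<Rightarrow> (int \<Rightarrow> 'a set) \<Rightarrow> int \<Rightarrow> 'a \<Rightarrow> 'a" where
  "rule_parents rule C k = rule k (C k) (C (k - 1))"

text \<open>\<open>M\<close> is the probability space carrying the choices \<open>y k p\<close>; \<open>idx k S\<close> enumerates the
  realised set \<open>S\<close> of points of generation \<open>k\<close>; \<open>rule\<close> is the fixed rule choosing the parents; and
  \<open>Q' \<omega>\<close> is any dyadic system built from the realised centres and parents (these determine the cubes
  only up to boundary points, and no measurability of \<open>Q'\<close> in \<open>\<omega>\<close> is required).\<close>

definition random_dyadic_system ::
    "real \<Rightarrow> 'w measure \<Rightarrow> (int \<Rightarrow> 'a::metric_space set) \<Rightarrow> (int \<Rightarrow> 'a \<Rightarrow> 'a) \<Rightarrow>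
     (int \<Rightarrow> 'a \<Rightarrow> 'w \<Rightarrow> 'a) \<Rightarrow> (int \<Rightarrow> 'a set \<Rightarrow> 'a \<Rightarrow> nat) \<Rightarrow>
     (int \<Rightarrow> 'a set \<Rightarrow> 'a set \<Rightarrow> 'a \<Rightarrow> 'a) \<Rightarrow> ('w \<Rightarrow> int \<Rightarrow> 'a \<Rightarrow> 'a set) \<Rightarrow> bool" where
  "random_dyadic_system \<delta> M Z zpar y idx rule Q' \<longleftrightarrow>
     (\<forall>k. maximal_separated (\<delta> powi k) (Z k)) \<and>
     parent_map (1 / 2) 1 \<delta> Z zpar \<and>
     prob_space M \<and>
     (\<forall>k. \<forall>p\<in>Z k. \<forall>\<omega>\<in>space M. y k p \<omega> \<in> children Z zpar k p) \<and>
     (\<forall>k. \<forall>p\<in>Z k. distr M (count_space UNIV) (y k p) =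
        measure_pmf (pmf_of_set (children Z zpar k p))) \<and>
     prob_space.indep_vars M (\<lambda>_. count_space UNIV) (\<lambda>(k, p). y k p) (SIGMA k:UNIV. Z k) \<and>
     (\<forall>\<omega>\<in>space M. \<forall>k. inj_on (idx k (random_points Z y \<omega> k)) (random_points Z y \<omega> k)) \<and>
     (\<forall>\<omega>\<in>space M. dyadic_system \<delta> (random_centres \<delta> Z y idx \<omega>)
        (rule_parents rule (random_centres \<delta> Z y idx \<omega>)) (Q' \<omega>))"

definition good_cube ::
    "real \<Rightarrow> real \<Rightarrow> nat \<Rightarrow> (int \<Rightarrow> 'a::metric_space set) \<Rightarrow> (int \<Rightarrow> 'a \<Rightarrow> 'a set) \<Rightarrow>
     (int \<Rightarrow> 'a \<Rightarrow> 'a set) \<Rightarrow> int \<times> 'a \<Rightarrow> bool" where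
  "good_cube \<delta> \<gamma> r C' Q' Q = (\<lambda>(k, p). \<forall>l. \<forall>q\<in>C' l. \<delta> powi k \<le> \<delta> ^ r * \<delta> powi l \<longrightarrow>
     eset_dist (Q k p) (Q' l q) \<ge> ennreal ((\<delta> powi k) powr \<gamma> * (\<delta> powi l) powr (1 - \<gamma>)) \<or>
     eset_dist (Q k p) (- Q' l q) \<ge> ennreal ((\<delta> powi k) powr \<gamma> * (\<delta> powi l) powr (1 - \<gamma>)))"

definition bad_cubes ::
    "real \<Rightarrow> real \<Rightarrow> nat \<Rightarrow> (int \<Rightarrow> 'a::metric_space set) \<Rightarrow> (int \<Rightarrow> 'a \<Rightarrow> 'a set) \<Rightarrow>
     (int \<Rightarrow> 'a set) \<Rightarrow> (int \<Rightarrow> 'a \<Rightarrow> 'a set) \<Rightarrow> (int \<times> 'a) set" where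
  "bad_cubes \<delta> \<gamma> r C' Q' C Q = {(k, p). p \<in> C k \<and> \<not> good_cube \<delta> \<gamma> r C' Q' Q (k, p)}"

definition cube_boundary :: "real \<Rightarrow> real \<Rightarrow> (int \<Rightarrow> 'a \<Rightarrow> 'a::metric_space set) \<Rightarrow> int \<times> 'a \<Rightarrow> 'a set" where
  "cube_boundary \<delta> \<epsilon> Q = (\<lambda>(k, p). {x. eset_dist {x} (Q k p) \<le> ennreal (\<epsilon> * \<delta> powi k) \<and>
     eset_dist {x} (- Q k p) \<le> ennreal (\<epsilon> * \<delta> powi k)})"

end

theory Submission
  imports Defs
begin

text \<open>If a centre \<open>p\<close> of generation \<open>l\<close> of a dyadic system happens to be within \<open>\<delta>^(l+1)\<close> of a point
  \<open>x\<close>, then the cube of \<open>p\<close> contains the ball of radius \<open>\<delta>^l / 200\<close> about \<open>x\<close>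
  (\<open>ball_subset_cube\<close>). As the cubes are nested, every cube of a coarser generation contains or
  misses this ball, so \<open>x\<close> is not within \<open>\<delta>^l / 200\<close> of both that cube and its complement
  (\<open>near_centre_not_in_boundary\<close>). For \<open>x\<close> to be in the \<open>\<epsilon> * \<delta>^k\<close>-boundary of a cube of generation
  \<open>k\<close>, no generation \<open>l \<ge> k\<close> with \<open>\<delta>^l / 200 > \<epsilon> * \<delta>^k\<close> may have such a centre; there are about
  \<open>log \<epsilon> / log \<delta>\<close> of these generations.

  In the random system, a generation \<open>l\<close> has a centre that close to \<open>x\<close> as soon as the finitely many
  net points within \<open>2 * \<delta>^l\<close> of \<open>x\<close> choose suitable children
  (\<open>prescribed_choice_gives_near_centre\<close>). By doubling this has probability at least some \<open>\<pi> > 0\<close>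
  that depends neither on \<open>l\<close> nor on \<open>x\<close>, and different generations are independent. Hence
  all the trials fail with probability at most \<open>(1 - \<pi>)^n\<close>, where \<open>n\<close> counts the generations, and
  this is a power \<open>\<epsilon>^\<eta>\<close> up to a constant (\<open>cube_boundary_prob\<close>).

  A cube of generation \<open>k\<close> that is bad because of a cube of generation \<open>k - m\<close> has its centre in the
  boundary of the latter with \<open>\<epsilon> = 6 * \<delta>^(m \<gamma>)\<close> (\<open>bad_cube_centre_in_boundary\<close>). Only \<open>m \<ge> r\<close>
  occur, and the boundary estimates for these \<open>m\<close> form a geometric series with sum of the order
  of its first term \<open>\<delta>^(r \<gamma> \<eta>)\<close>.

  An event about the random cubes may fail to be measurable in \<open>\<omega>\<close>, so it is always enclosed in
  a measurable event about the choices of finitely or countably many generations.\<close>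

section \<open>Counting separated points in doubling spaces\<close>

lemma doubling_cover_iterate:
  assumes "geometrically_doubling TYPE('a::metric_space)"
  obtains D :: nat where "\<And>(x::'a) R. 0 < R \<Longrightarrow>
    \<exists>A. finite A \<and> card A \<le> D \<and> ball x R \<subseteq> (\<Union>a\<in>A. ball a (R / 2 ^ j))"
proof -
  obtain N :: nat where N: "\<And>(x::'a) r. 0 < r \<Longrightarrow>
        \<exists>A. finite A \<and> card A \<le> N \<and> ball x r \<subseteq> (\<Union>a\<in>A. ball a (r / 2))"
    using assms unfolding geometrically_doubling_def by auto
  have "\<forall>(x::'a) R. 0 < R \<longrightarrow>
    (\<exists>A. finite A \<and> card A \<le> N ^ j \<and> ball x R \<subseteq> (\<Union>a\<in>A. ball a (R / 2 ^ j)))"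
  proof (induction j)
    case 0
    show ?case by (intro allI impI) (rule_tac x = "{x}" in exI, auto)
  next
    case (Suc j)
    show ?case
    proof (intro allI impI)
      fix x :: 'a and R :: real
      assume R: "0 < R"
      then obtain A where A: "finite A" "card A \<le> N ^ j"
        "ball x R \<subseteq> (\<Union>a\<in>A. ball a (R / 2 ^ j))"
        using Suc by blast
      have "\<forall>a::'a. \<exists>B. finite B \<and> card B \<le> N \<and>
          ball a (R / 2 ^ j) \<subseteq> (\<Union>b\<in>B. ball b (R / 2 ^ j / 2))"
        by (intro allI N divide_pos_pos R) simp
      then obtain B where B: "\<And>a::'a. finite (B a)" "\<And>a::'a. card (B a) \<le> N"
        "\<And>a::'a. ball a (R / 2 ^ j) \<subseteq> (\<Union>b\<in>B a. ball b (R / 2 ^ j / 2))"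
        by metis
      have "card (\<Union>a\<in>A. B a) \<le> (\<Sum>a\<in>A. card (B a))"
        by (rule card_UN_le) (rule A)
      also have "\<dots> \<le> card A * N"
        using sum_bounded_above[of A "\<lambda>a. card (B a)" N] B(2) by simp
      also have "\<dots> \<le> N ^ Suc j"
        using A(2) by (simp add: mult.commute)
      finally have card: "card (\<Union>a\<in>A. B a) \<le> N ^ Suc j" .
      have "ball x R \<subseteq> (\<Union>a\<in>A. ball a (R / 2 ^ j))" by (rule A)
      also have "\<dots> \<subseteq> (\<Union>a\<in>A. \<Union>b\<in>B a. ball b (R / 2 ^ j / 2))"
        by (rule UN_mono[OF order_refl B(3)])
      also have "\<dots> = (\<Union>b\<in>(\<Union>a\<in>A. B a). ball b (R / 2 ^ Suc j))"
        by (simp add: mult.commute)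
      finally show "\<exists>A. finite A \<and> card A \<le> N ^ Suc j \<and> ball x R \<subseteq> (\<Union>a\<in>A. ball a (R / 2 ^ Suc j))"
        using A(1) B(1) card by (intro exI[of _ "\<Union>a\<in>A. B a"]) auto
    qed
  qed
  then show thesis by (intro that) blast
qed

text \<open>A ball of radius \<open>s / 2\<close> contains at most one point of an \<open>s\<close>-separated set, so such a set
  has no more points in a ball than the number of these small balls that is needed to cover it.\<close>

lemma doubling_separated_bound:
  assumes "geometrically_doubling TYPE('a::metric_space)"
  obtains D :: nat where "\<And>(x::'a) R s S. \<lbrakk>0 < R; 0 < s; 2 * R \<le> K * s; separated s S; S \<subseteq> ball x R\<rbrakk> \<Longrightarrow>
    finite S \<and> card S \<le> D"
proof -
  obtain j where j: "K < 2 ^ j"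
    using real_arch_pow[of 2 K] by auto
  obtain D :: nat where D: "\<And>(x::'a) R. 0 < R \<Longrightarrow>
    \<exists>A. finite A \<and> card A \<le> D \<and> ball x R \<subseteq> (\<Union>a\<in>A. ball a (R / 2 ^ j))"
    using doubling_cover_iterate[OF assms] by blast
  show thesis
  proof (rule that)
    fix x :: 'a and R s :: real and S
    assume R: "0 < R" and s: "0 < s" and Rs: "2 * R \<le> K * s"
      and sep: "separated s S" and sub: "S \<subseteq> ball x R"
    obtain A where A: "finite A" "card A \<le> D" "ball x R \<subseteq> (\<Union>a\<in>A. ball a (R / 2 ^ j))"
      using D[OF R] by blast
    have "K * s \<le> 2 ^ j * s" using j s by simp
    then have "2 * R \<le> 2 ^ j * s" using Rs by linarith
    then have small: "R / 2 ^ j + R / 2 ^ j \<le> s" by (simp add: field_simps)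
    have "\<forall>p\<in>S. \<exists>a\<in>A. dist a p < R / 2 ^ j"
      using sub A(3) by fastforce
    then obtain f where f: "\<And>p. p \<in> S \<Longrightarrow> f p \<in> A" "\<And>p. p \<in> S \<Longrightarrow> dist (f p) p < R / 2 ^ j"
      by metis
    have inj: "inj_on f S"
    proof (rule inj_onI, rule ccontr)
      fix p q assume pq: "p \<in> S" "q \<in> S" "f p = f q" "p \<noteq> q"
      have "dist p q \<le> dist (f p) p + dist (f p) q" by (rule dist_triangle3)
      also have "\<dots> < s" using f(2)[of p] f(2)[of q] pq small by simp
      finally show False using sep pq unfolding separated_def by force
    qed
    have "f ` S \<subseteq> A" using f(1) by blast
    then show "finite S \<and> card S \<le> D"
      using inj A(1,2) by (metis card_inj_on_le inj_on_finite order_trans)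
  qed
qed

section \<open>Ancestors of centres\<close>

lemma descends_level: "((l, q), (k, p)) \<in> descends C par \<Longrightarrow> k \<le> l"
  unfolding descends_def by (induction rule: converse_rtrancl_induct2) auto

lemma descends_refl: "((k, p), (k, p)) \<in> descends C par"
  unfolding descends_def by simp

lemma descends_parent:
  assumes "q \<in> C l" and "((l - 1, par l q), (k, p)) \<in> descends C par"
  shows "((l, q), (k, p)) \<in> descends C par"
  using assms unfolding descends_def by (auto intro: converse_rtrancl_into_rtrancl)

lemma descendsE:
  assumes "((l, q), (k, p)) \<in> descends C par"
  obtains "l = k" "q = p"
    | "k < l" "q \<in> C l" "((l - 1, par l q), (k, p)) \<in> descends C par"
proof -
  consider "(l, q) = (k, p)" | "q \<in> C l" "((l - 1, par l q), (k, p)) \<in> descends C par"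
    using assms unfolding descends_def by (auto elim: converse_rtranclE)
  then show thesis
  proof cases
    case 1
    then show ?thesis using that(1) by simp
  next
    case 2
    then show ?thesis using that(2) descends_level[OF 2(2)] by simp
  qed
qed

lemma descends_induct [consumes 1, case_names refl parent]:
  assumes "((l, q), (k, p)) \<in> descends C par"
    and "P k p"
    and "\<And>l q. \<lbrakk>q \<in> C l; ((l - 1, par l q), (k, p)) \<in> descends C par; P (l - 1) (par l q)\<rbrakk> \<Longrightarrow> P l q"
  shows "P l q"
  using assms(1) unfolding descends_def
proof (induction rule: converse_rtrancl_induct2)
  case refl
  show ?case by (rule assms(2))
next
  case (step l q l' q')
  then show ?case using assms(3)[of q l] unfolding descends_def by auto
qed

lemma descends_unique:
  assumes "((l, q), (k, p)) \<in> descends C par" and "((l, q), (k, p')) \<in> descends C par"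
  shows "p = p'"
  using assms
proof (induction rule: descends_induct)
  case refl
  then show ?case by (auto elim: descendsE)
next
  case (parent l q)
  then show ?case using descends_level[OF parent(2)] by (auto elim: descendsE)
qed

lemma descends_between:
  assumes "((m, u), (k, p)) \<in> descends C par" and "k \<le> l" and "l \<le> m"
  obtains v where "((m, u), (l, v)) \<in> descends C par" "((l, v), (k, p)) \<in> descends C par"
proof -
  have "\<exists>v. ((m, u), (l, v)) \<in> descends C par \<and> ((l, v), (k, p)) \<in> descends C par"
    using assms(1,3)
  proof (induction rule: descends_induct)
    case refl
    then show ?case using assms(2) by (auto intro: descends_refl)
  next
    case (parent m u)
    show ?case
    proof (cases "l = m")
      case True
      then show ?thesis using parent by (auto intro: descends_refl descends_parent)
    next
      case False
      then show ?thesis using parent by (force intro: descends_parent)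
    qed
  qed
  then show thesis using that by blast
qed

lemma descends_in_centres:
  assumes "((l, q), (k, p)) \<in> descends C par" and "p \<in> C k"
  shows "q \<in> C l"
  using assms by (auto elim: descendsE)

lemma parent_dist:
  assumes "parent_map a b \<delta> C par" and "a \<le> b" and "0 < \<delta>" and "q \<in> C l"
  shows "dist q (par l q) < b * \<delta> powi (l - 1)"
proof -
  have "a * \<delta> powi (l - 1) \<le> b * \<delta> powi (l - 1)"
    using assms by (intro mult_right_mono) auto
  then show ?thesis
    using assms(1,4) unfolding parent_map_def by (smt (verit))
qed

lemma parent_eq_near:
  assumes "parent_map a b \<delta> C par" and "separated s (C (l - 1))" and "2 * a * \<delta> powi (l - 1) \<le> s"
    and "q \<in> C l" and "p \<in> C (l - 1)" and "dist q p < a * \<delta> powi (l - 1)"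
  shows "par l q = p"
proof (rule ccontr)
  assume ne: "par l q \<noteq> p"
  have *: "par l q \<in> C (l - 1)" "dist q (par l q) < a * \<delta> powi (l - 1)"
    using assms(1,4,5,6) unfolding parent_map_def by (smt (verit))+
  have "dist (par l q) p \<le> dist q (par l q) + dist q p" by (rule dist_triangle3)
  also have "\<dots> < s" using * assms(3,6) by linarith
  finally show False using assms(2,5) * ne unfolding separated_def by force
qed

text \<open>A chain of parents moves by at most \<open>b * \<delta>^(m-1)\<close> when it leaves generation \<open>m\<close>; the bound
  below is the sum of this geometric progression over \<open>k < m \<le> l\<close>.\<close>

lemma descends_dist:
  assumes "parent_map a b \<delta> C par" and "a \<le> b" and "0 < \<delta>" and "\<delta> < 1"
    and "((l, q), (k, p)) \<in> descends C par"
  shows "dist q p \<le> b / (1 - \<delta>) * (\<delta> powi k - \<delta> powi l)"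
  using assms(5)
proof (induction rule: descends_induct)
  case refl
  show ?case by simp
next
  case (parent l q)
  have "dist q p \<le> dist q (par l q) + dist (par l q) p" by (rule dist_triangle)
  also have "\<dots> \<le> b * \<delta> powi (l - 1) + b / (1 - \<delta>) * (\<delta> powi k - \<delta> powi (l - 1))"
    using parent_dist[OF assms(1,2,3) parent(1)] parent(3) by linarith
  also have "\<delta> powi l = \<delta> * \<delta> powi (l - 1)"
    using assms(3) by (simp add: power_int_diff)
  then have "b * \<delta> powi (l - 1) + b / (1 - \<delta>) * (\<delta> powi k - \<delta> powi (l - 1))
      = b / (1 - \<delta>) * (\<delta> powi k - \<delta> powi l)"
    using assms(4) by (simp add: field_simps)
  finally show ?case .
qed

section \<open>Size and interior of the cubes\<close>

lemma dyadic_systemD: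
  assumes "dyadic_system \<delta> C par Q"
  shows "dyadic_centres \<delta> C" and "parent_map (1 / 16) 4 \<delta> C par"
    and "p \<in> C k \<Longrightarrow> dyadic_inner \<delta> C par k p \<subseteq> Q k p"
    and "p \<in> C k \<Longrightarrow> Q k p \<subseteq> closure (dyadic_open \<delta> C par k p)"
    and "k \<le> l \<Longrightarrow> p \<in> C k \<Longrightarrow> q \<in> C l \<Longrightarrow> Q l q \<subseteq> Q k p \<or> Q l q \<inter> Q k p = {}"
proof -
  note sys = assms[unfolded dyadic_system_def]
  show "dyadic_centres \<delta> C" using sys by (elim conjE)
  show "parent_map (1 / 16) 4 \<delta> C par" using sys by (elim conjE)
  have "\<forall>k. \<forall>p\<in>C k. Q k p \<in> sets borel \<and>
        dyadic_inner \<delta> C par k p \<subseteq> Q k p \<and> Q k p \<subseteq> closure (dyadic_open \<delta> C par k p)"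
    using sys by (elim conjE)
  then show "p \<in> C k \<Longrightarrow> dyadic_inner \<delta> C par k p \<subseteq> Q k p"
    and "p \<in> C k \<Longrightarrow> Q k p \<subseteq> closure (dyadic_open \<delta> C par k p)" by blast+
  have "\<forall>k l. k \<le> l \<longrightarrow> (\<forall>p\<in>C k. \<forall>q\<in>C l. Q l q \<subseteq> Q k p \<or> Q l q \<inter> Q k p = {})"
    using sys by (elim conjE)
  then show "k \<le> l \<Longrightarrow> p \<in> C k \<Longrightarrow> q \<in> C l \<Longrightarrow> Q l q \<subseteq> Q k p \<or> Q l q \<inter> Q k p = {}"
    by blast
qed

lemma descends_dist_fine:
  assumes "parent_map (1 / 16) 4 \<delta> C par" and "0 < \<delta>" and "\<delta> \<le> 1 / 1000"
    and "((l, q), (k, p)) \<in> descends C par"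
  shows "dist q p \<le> 41 / 10 * \<delta> powi k"
proof -
  have "dist q p \<le> 4 / (1 - \<delta>) * (\<delta> powi k - \<delta> powi l)"
    using descends_dist[OF assms(1) _ assms(2) _ assms(4)] assms(3) by simp
  also have "\<dots> \<le> 4 / (1 - \<delta>) * \<delta> powi k"
    using assms(2,3) by (intro mult_left_mono) auto
  also have "\<dots> \<le> 41 / 10 * \<delta> powi k"
    using assms(2,3) by (intro mult_right_mono) (auto simp: field_simps)
  finally show ?thesis .
qed

text \<open>Suppose that the ball of \<open>(l, t)\<close> meets the ball of a finer \<open>(m, u)\<close>. Since the
  displacement of \<open>u\<close> up to generation \<open>l + 1\<close> is of size \<open>\<delta>^(l+1)\<close>, the ancestor of \<open>u\<close> in that
  generation is within \<open>\<delta>^l / 16\<close> of \<open>t\<close>. The first parent rule then makes \<open>t\<close> its parent, and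
  the two chains have merged.\<close>

lemma descendants_with_meeting_balls:
  assumes "dyadic_centres \<delta> C" and "parent_map (1 / 16) 4 \<delta> C par"
    and "0 < \<delta>" and "\<delta> \<le> 1 / 1000" and "p \<in> C k" and "p' \<in> C k"
    and t: "((l, t), (k, p)) \<in> descends C par" and u: "((m, u), (k, p')) \<in> descends C par"
    and "l \<le> m" and near: "dist t u < \<delta> powi l / 100 + \<delta> powi m / 100"
  shows "p = p'"
proof -
  note tC = descends_in_centres[OF t assms(5)]
  note uC = descends_in_centres[OF u assms(6)]
  have sep: "separated (\<delta> powi l / 8) (C l)"
    using assms(1) unfolding dyadic_centres_def by blast
  have pos: "0 < \<delta> powi l" using assms(3) by simp
  show ?thesis
  proof (cases "l = m")
    case True
    have "dist t u < \<delta> powi l / 8" using near True pos by simp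
    then have "t = u" using sep tC uC True unfolding separated_def by force
    then show ?thesis using descends_unique t u True by metis
  next
    case False
    then have lm: "l + 1 \<le> m" using \<open>l \<le> m\<close> by simp
    have kl: "k \<le> l" by (rule descends_level[OF t])
    obtain v where v: "((m, u), (l + 1, v)) \<in> descends C par" "((l + 1, v), (k, p')) \<in> descends C par"
      using descends_between[OF u _ lm] kl by auto
    have vC: "v \<in> C (l + 1)" and par: "((l, par (l + 1) v), (k, p')) \<in> descends C par"
      using v(2) kl by (auto elim: descendsE)
    have small: "\<delta> powi (l + 1) \<le> \<delta> powi l / 1000"
      using assms(3,4) pos by (simp add: power_int_add)
    have "\<delta> powi m \<le> \<delta> powi (l + 1)"
      using lm assms(3,4) by (intro power_int_decreasing) auto
    moreover have "dist u v \<le> 41 / 10 * \<delta> powi (l + 1)"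
      by (rule descends_dist_fine[OF assms(2,3,4) v(1)])
    moreover have "dist v t \<le> dist u v + dist t u"
      by (metis dist_commute dist_triangle3)
    ultimately have "dist v t < 1 / 16 * \<delta> powi (l + 1 - 1)"
      using near small pos by simp
    then have "par (l + 1) v = t"
      using parent_eq_near[OF assms(2), of "\<delta> powi l / 8" "l + 1" v t] sep vC tC by simp
    then show ?thesis using descends_unique[OF t] par by simp
  qed
qed

lemma dyadic_open_disjoint:
  assumes "dyadic_centres \<delta> C" and "parent_map (1 / 16) 4 \<delta> C par"
    and "0 < \<delta>" and "\<delta> \<le> 1 / 1000" and "p \<in> C k" and "p' \<in> C k" and "p \<noteq> p'"
  shows "dyadic_open \<delta> C par k p \<inter> dyadic_open \<delta> C par k p' = {}"
proof (rule ccontr)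
  assume "dyadic_open \<delta> C par k p \<inter> dyadic_open \<delta> C par k p' \<noteq> {}"
  then obtain w l t m u where t: "((l, t), (k, p)) \<in> descends C par" "dist t w < \<delta> powi l / 100"
    and u: "((m, u), (k, p')) \<in> descends C par" "dist u w < \<delta> powi m / 100"
    unfolding dyadic_open_def by auto
  have near: "dist t u < \<delta> powi l / 100 + \<delta> powi m / 100"
    using t(2) u(2) dist_triangle2[of t u w] by linarith
  have "p = p'"
  proof (cases "l \<le> m")
    case True
    show ?thesis
      by (rule descendants_with_meeting_balls[OF assms(1-6) t(1) u(1) True near])
  next
    case False
    have "dist u t < \<delta> powi m / 100 + \<delta> powi l / 100"
      using near by (simp only: dist_commute[of u t] add.commute)
    then have "p' = p"
      using descendants_with_meeting_balls[OF assms(1-4,6,5) u(1) t(1)] False by linarith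
    then show ?thesis by (rule sym)
  qed
  then show False using assms(7) by contradiction
qed

lemma cube_subset_cball:
  assumes "dyadic_system \<delta> C par Q" and "0 < \<delta>" and "\<delta> \<le> 1 / 1000" and "p \<in> C k"
  shows "Q k p \<subseteq> cball p (5 * \<delta> powi k)"
proof -
  note pm = dyadic_systemD(2)[OF assms(1)]
  note sub = dyadic_systemD(4)[OF assms(1,4)]
  have "dyadic_open \<delta> C par k p \<subseteq> cball p (5 * \<delta> powi k)"
  proof
    fix w assume "w \<in> dyadic_open \<delta> C par k p"
    then obtain l q where q: "((l, q), (k, p)) \<in> descends C par" "dist q w < \<delta> powi l / 100"
      unfolding dyadic_open_def by auto
    have "\<delta> powi l \<le> \<delta> powi k"
      using descends_level[OF q(1)] assms(2,3) by (intro power_int_decreasing) auto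
    moreover have "dist q p \<le> 41 / 10 * \<delta> powi k"
      by (rule descends_dist_fine[OF pm assms(2,3) q(1)])
    moreover have "dist p w \<le> dist q p + dist q w" by (rule dist_triangle3)
    moreover have "0 < \<delta> powi k" using assms(2) by simp
    ultimately show "w \<in> cball p (5 * \<delta> powi k)" using q(2) by simp
  qed
  from sub closure_minimal[OF this closed_cball] show ?thesis by (rule order_trans)
qed

text \<open>The open ball of \<open>p\<close> in the generation of \<open>p\<close> itself is disjoint from the sets
  \<open>dyadic_open\<close> of the other centres, hence from their closures. So it is part of
  \<open>dyadic_inner\<close>, which every choice of the half-open cubes has to respect.\<close>

lemma ball_subset_cube:
  assumes "dyadic_system \<delta> C par Q" and "0 < \<delta>" and "\<delta> \<le> 1 / 1000" and "p \<in> C l"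
    and "dist x p < \<delta> powi (l + 1)"
  shows "ball x (\<delta> powi l / 200) \<subseteq> Q l p"
proof -
  note sys = dyadic_systemD(1,2)[OF assms(1)]
  note inner = dyadic_systemD(3)[OF assms(1,4)]
  have pos: "0 < \<delta> powi l" using assms(2) by simp
  have "\<delta> powi (l + 1) \<le> \<delta> powi l / 1000"
    using assms(2,3) pos by (simp add: power_int_add)
  then have "ball x (\<delta> powi l / 200) \<subseteq> ball p (\<delta> powi l / 100)"
  proof (intro subsetI)
    fix w assume "w \<in> ball x (\<delta> powi l / 200)"
    moreover have "dist p w \<le> dist x p + dist x w" by (rule dist_triangle3)
    ultimately show "w \<in> ball p (\<delta> powi l / 100)"
      using assms(5) pos \<open>\<delta> powi (l + 1) \<le> \<delta> powi l / 1000\<close> by simp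
  qed
  also have "\<dots> \<subseteq> dyadic_inner \<delta> C par l p"
  proof -
    have "ball p (\<delta> powi l / 100) \<inter> closure (dyadic_open \<delta> C par l q) = {}"
      if q: "q \<in> C l - {p}" for q
    proof -
      have "ball p (\<delta> powi l / 100) \<subseteq> dyadic_open \<delta> C par l p"
        unfolding dyadic_open_def using descends_refl[of l p C par]
        by (intro UN_upper[of "(l, p)", THEN order_trans[rotated]]) auto
      then have "ball p (\<delta> powi l / 100) \<inter> dyadic_open \<delta> C par l q = {}"
        using dyadic_open_disjoint[OF sys assms(2,3,4), of q] q by blast
      then show ?thesis by (simp add: open_Int_closure_eq_empty)
    qed
    then show ?thesis unfolding dyadic_inner_def by blast
  qed
  finally show ?thesis using inner by blast
qed

text \<open>The ball about \<open>x\<close> lies in a cube of generation \<open>l\<close>, and a coarser cube either contains or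
  misses that cube. Hence \<open>x\<close> is far from the coarser cube or far from its complement.\<close>

lemma near_centre_not_in_boundary:
  assumes "dyadic_system \<delta> C par Q" and "0 < \<delta>" and "\<delta> \<le> 1 / 1000" and "p \<in> C l"
    and "dist x p < \<delta> powi (l + 1)" and "k \<le> l" and "q \<in> C k"
    and "\<epsilon> * \<delta> powi k < \<delta> powi l / 200"
  shows "x \<notin> cube_boundary \<delta> \<epsilon> Q (k, q)"
proof -
  have far: "\<not> eset_dist {x} R \<le> ennreal (\<epsilon> * \<delta> powi k)" if "R \<inter> ball x (\<delta> powi l / 200) = {}" for R
  proof -
    have "ennreal (\<epsilon> * \<delta> powi k) < ennreal (\<delta> powi l / 200)"
      using assms(2,8) by (intro ennreal_lessI) auto
    also have "\<dots> \<le> eset_dist {x} R"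
      unfolding eset_dist_def using that by (auto intro!: INF_greatest ennreal_leI)
    finally show ?thesis by simp
  qed
  have "Q l p \<subseteq> Q k q \<or> Q l p \<inter> Q k q = {}"
    using dyadic_systemD(5)[OF assms(1,6,7,4)] .
  then have "(- Q k q) \<inter> ball x (\<delta> powi l / 200) = {} \<or> Q k q \<inter> ball x (\<delta> powi l / 200) = {}"
    using ball_subset_cube[OF assms(1-5)] by blast
  then show ?thesis unfolding cube_boundary_def using far by auto
qed

section \<open>Thinning\<close>

lemma thinned_below_subset: "thinned_below idx s S n \<subseteq> {p \<in> S. idx p < n}"
  by (induction n) auto

lemma isolated_point_is_kept:
  assumes "p \<in> S" and "\<And>q. q \<in> S \<Longrightarrow> dist p q < s \<Longrightarrow> q = p"
  shows "p \<in> thinned idx s S"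
proof -
  have "\<not> dist p q < s" if "q \<in> thinned_below idx s S (idx p)" for q
  proof
    assume "dist p q < s"
    moreover have "q \<in> S" "idx q < idx p"
      using that thinned_below_subset[of idx s S "idx p"] by auto
    ultimately show False using assms(2)[of q] by simp
  qed
  then have "p \<in> thinned_below idx s S (Suc (idx p))"
    using assms(1) by simp
  then show ?thesis unfolding thinned_def by blast
qed

section \<open>Nets and their children\<close>

lemma maximal_separated_net:
  assumes "maximal_separated s A" and "0 < s"
  obtains z where "z \<in> A" and "dist x z < s"
proof -
  have sep: "separated s A" and max: "\<And>B. separated s B \<Longrightarrow> A \<subseteq> B \<Longrightarrow> B = A"
    using assms(1) unfolding maximal_separated_def by simp_all
  have "\<exists>z\<in>A. dist x z < s"
  proof (rule ccontr)
    assume "\<not> (\<exists>z\<in>A. dist x z < s)"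
    then have far: "\<And>z. z \<in> A \<Longrightarrow> s \<le> dist x z" by force
    have "separated s (insert x A)"
      unfolding separated_def
    proof (intro ballI impI)
      fix u v assume "u \<in> insert x A" "v \<in> insert x A" "u \<noteq> v"
      then consider "u = x" "v \<in> A" | "v = x" "u \<in> A" | "u \<in> A" "v \<in> A" by blast
      then show "s \<le> dist u v"
      proof cases
        case 1
        then show ?thesis using far by simp
      next
        case 2
        then show ?thesis using far[of u] by (simp add: dist_commute)
      next
        case 3
        then show ?thesis using sep \<open>u \<noteq> v\<close> unfolding separated_def by simp
      qed
    qed
    then have "x \<in> A" using max[of "insert x A"] by blast
    then show False using far[of x] assms(2) by simp
  qed
  then show thesis using that by blast
qed

lemma children_iff: "q \<in> children Z zpar k p \<longleftrightarrow> q \<in> Z (k + 1) \<and> zpar (k + 1) q = p"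
proof
  assume "q \<in> children Z zpar k p"
  then have "((k + 1, q), (k, p)) \<in> descends Z zpar" unfolding children_def by simp
  then show "q \<in> Z (k + 1) \<and> zpar (k + 1) q = p"
  proof (cases rule: descendsE)
    case 2
    have "((k, zpar (k + 1) q), (k, p)) \<in> descends Z zpar" using 2(3) by simp
    then show ?thesis using 2(2) by (auto elim: descendsE)
  qed simp
next
  assume "q \<in> Z (k + 1) \<and> zpar (k + 1) q = p"
  then have "((k + 1, q), (k, p)) \<in> descends Z zpar"
    using descends_parent[of q Z "k + 1" zpar k p] by (simp add: descends_refl)
  then show "q \<in> children Z zpar k p" unfolding children_def by simp
qed

text \<open>Let \<open>\<beta>\<close> be a net point of generation \<open>l + 1\<close> within \<open>\<delta>^(l+1)\<close> of \<open>x\<close> and \<open>\<sigma>\<close> its parent. If \<open>\<sigma>\<close>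
  chooses \<open>\<beta>\<close>, and every other net point near \<open>x\<close> chooses a child within \<open>\<delta>^(l+1)\<close> of itself, then no
  chosen point conflicts with \<open>\<beta>\<close>: a conflicting choice would come from a net point within
  \<open>\<delta>^l / 2\<close> of \<open>\<beta>\<close>, and the first parent rule would make that point the parent of \<open>\<beta>\<close>.
  Points without conflicts survive the thinning whatever the enumeration is.\<close>

lemma prescribed_choice_gives_near_centre:
  assumes net: "\<And>k. maximal_separated (\<delta> powi k) (Z k)" and pm: "parent_map (1 / 2) 1 \<delta> Z zpar"
    and "0 < \<delta>" and "\<delta> \<le> 1 / 1000"
  obtains t where "\<And>z. z \<in> Z l \<Longrightarrow> t z \<in> children Z zpar l z"
    and "Z l \<inter> ball x (2 * \<delta> powi l) \<noteq> {}"
    and "\<And>c idx. \<lbrakk>\<And>z. z \<in> Z l \<Longrightarrow> c z \<in> children Z zpar l z;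
        \<And>z. z \<in> Z l \<inter> ball x (2 * \<delta> powi l) \<Longrightarrow> c z = t z\<rbrakk> \<Longrightarrow>
      \<exists>p\<in>thinned idx (\<delta> powi l / 4) (c ` Z l). dist x p < \<delta> powi (l + 1)"
proof -
  have pos: "\<And>k. 0 < \<delta> powi k" using assms(3) by simp
  have small: "\<delta> powi (l + 1) \<le> \<delta> powi l / 1000"
    using assms(3,4) pos[of l] by (simp add: power_int_add)
  have sep: "separated (\<delta> powi l) (Z l)"
    using net unfolding maximal_separated_def by blast
  have near_parent: "zpar (l + 1) q = z"
    if "q \<in> Z (l + 1)" "z \<in> Z l" "dist q z < \<delta> powi l / 2" for q z
    using parent_eq_near[OF pm, of "\<delta> powi l" "l + 1" q z] sep that by simp
  have child_dist: "dist q z < \<delta> powi l" if "q \<in> children Z zpar l z" for q z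
    using parent_dist[OF pm _ assms(3), of q "l + 1"] that by (simp add: children_iff)
  obtain \<beta> where \<beta>: "\<beta> \<in> Z (l + 1)" "dist x \<beta> < \<delta> powi (l + 1)"
    using maximal_separated_net[OF net pos] by blast
  define \<sigma> where "\<sigma> = zpar (l + 1) \<beta>"
  have \<beta>\<sigma>: "\<beta> \<in> children Z zpar l \<sigma>" using \<beta>(1) by (simp add: children_iff \<sigma>_def)
  have \<sigma>: "\<sigma> \<in> Z l"
    using pm \<beta>(1) unfolding parent_map_def \<sigma>_def by (metis add_diff_cancel_right')
  have "dist x \<sigma> \<le> dist x \<beta> + dist \<beta> \<sigma>" by (rule dist_triangle)
  then have \<sigma>x: "\<sigma> \<in> ball x (2 * \<delta> powi l)"
    using \<beta>(2) child_dist[OF \<beta>\<sigma>] small pos[of l] by simp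
  have "\<forall>z. \<exists>q. q \<in> Z (l + 1) \<and> dist z q < \<delta> powi (l + 1)"
    using maximal_separated_net[OF net pos] by metis
  then obtain s where s: "\<And>z. s z \<in> Z (l + 1)" "\<And>z. dist z (s z) < \<delta> powi (l + 1)"
    by metis
  have schild: "s z \<in> children Z zpar l z" if "z \<in> Z l" for z
  proof -
    have "dist (s z) z < \<delta> powi l / 2"
      using s(2)[of z] small pos[of l] by (simp add: dist_commute)
    then show ?thesis using near_parent[OF s(1) that] s(1) by (simp add: children_iff)
  qed
  define t where "t = s(\<sigma> := \<beta>)"
  show thesis
  proof (rule that)
    show "t z \<in> children Z zpar l z" if "z \<in> Z l" for z
      using schild[OF that] \<beta>\<sigma> by (simp add: t_def)
    show "Z l \<inter> ball x (2 * \<delta> powi l) \<noteq> {}" using \<sigma> \<sigma>x by blast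
    fix c :: "'a \<Rightarrow> 'a" and idx :: "'a \<Rightarrow> nat"
    assume c: "\<And>z. z \<in> Z l \<Longrightarrow> c z \<in> children Z zpar l z"
      and ct: "\<And>z. z \<in> Z l \<inter> ball x (2 * \<delta> powi l) \<Longrightarrow> c z = t z"
    have c\<sigma>: "c \<sigma> = \<beta>" using ct[of \<sigma>] \<sigma> \<sigma>x by (simp add: t_def)
    have "\<beta> \<in> thinned idx (\<delta> powi l / 4) (c ` Z l)"
    proof (rule isolated_point_is_kept)
      show "\<beta> \<in> c ` Z l" using c\<sigma> \<sigma> by blast
      fix q assume "q \<in> c ` Z l" and q: "dist \<beta> q < \<delta> powi l / 4"
      then obtain z where z: "z \<in> Z l" "q = c z" by blast
      have qz: "dist q z < \<delta> powi l" using child_dist[OF c[OF z(1)]] z(2) by simp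
      have "dist x z \<le> dist x \<beta> + dist \<beta> q + dist q z"
        using dist_triangle[of x z \<beta>] dist_triangle[of \<beta> z q] by linarith
      then have "z \<in> ball x (2 * \<delta> powi l)"
        using \<beta>(2) q qz small pos[of l] by simp
      then have qt: "q = t z" using ct z by simp
      show "q = \<beta>"
      proof (cases "z = \<sigma>")
        case True
        then show ?thesis using qt by (simp add: t_def)
      next
        case False
        then have "dist z q < \<delta> powi (l + 1)" using qt s(2) by (simp add: t_def)
        moreover have "dist \<beta> z \<le> dist \<beta> q + dist z q" by (rule dist_triangle2)
        ultimately have "dist \<beta> z < \<delta> powi l / 2" using q small pos[of l] by simp
        then have "\<sigma> = z" using near_parent[OF \<beta>(1) z(1)] by (simp add: \<sigma>_def)
        then show ?thesis using False by simp
      qed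
    qed
    then show "\<exists>p\<in>thinned idx (\<delta> powi l / 4) (c ` Z l). dist x p < \<delta> powi (l + 1)"
      using \<beta>(2) by blast
  qed
qed

section \<open>Independent trials\<close>

text \<open>The trial \<open>l\<close> is the event that the variables \<open>X i\<close> with \<open>i \<in> K l\<close> all take prescribed
  values. Trials with disjoint \<open>K l\<close> are independent, and each of them succeeds with probability at
  least \<open>q ^ m\<close>.\<close>

lemma (in prob_space) all_trials_miss:
  fixes X :: "'i \<Rightarrow> 'a \<Rightarrow> 'b"
  assumes ind: "indep_vars (\<lambda>_. count_space UNIV) X I"
    and K: "\<And>l. l \<in> L \<Longrightarrow> K l \<subseteq> I" "disjoint_family_on K L"
    and fin: "finite L" "\<And>l. l \<in> L \<Longrightarrow> finite (K l)" and ne: "\<And>l. l \<in> L \<Longrightarrow> K l \<noteq> {}"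
    and card: "\<And>l. l \<in> L \<Longrightarrow> card (K l) \<le> m"
    and q: "0 \<le> q" "q \<le> 1"
    and hit: "\<And>l i. l \<in> L \<Longrightarrow> i \<in> K l \<Longrightarrow> q \<le> prob {\<omega> \<in> space M. X i \<omega> = t i}"
  shows "{\<omega> \<in> space M. \<forall>l\<in>L. \<exists>i\<in>K l. X i \<omega> \<noteq> t i} \<in> events"
    and "prob {\<omega> \<in> space M. \<forall>l\<in>L. \<exists>i\<in>K l. X i \<omega> \<noteq> t i} \<le> (1 - q ^ m) ^ card L"
proof -
  have X: "X i \<in> measurable M (count_space UNIV)" if "i \<in> I" for i
    using ind that unfolding indep_vars_def by blast
  have single: "{\<omega> \<in> space M. X i \<omega> = t i} \<in> events" if "i \<in> I" for i
    using measurable_sets[OF X[OF that], of "{t i}"] by (simp add: vimage_def Int_def conj_commute)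
  define F where "F l = {\<omega> \<in> space M. \<forall>i\<in>K l. X i \<omega> = t i}" for l
  have F: "F l \<in> events" if "l \<in> L" for l
    unfolding F_def using single K(1)[OF that] fin(2)[OF that]
    by (intro sets.sets_Collect_finite_All) auto
  have miss: "{\<omega> \<in> space M. \<forall>l\<in>L. \<exists>i\<in>K l. X i \<omega> \<noteq> t i} = {\<omega> \<in> space M. \<forall>l\<in>L. \<omega> \<in> space M - F l}"
    unfolding F_def by auto
  show "{\<omega> \<in> space M. \<forall>l\<in>L. \<exists>i\<in>K l. X i \<omega> \<noteq> t i} \<in> events"
    unfolding miss
  proof (intro sets.sets_Collect_finite_All fin(1))
    fix l assume "l \<in> L"
    then have "space M - F l \<in> events" using F by blast
    moreover have "{x \<in> space M. x \<in> space M - F l} = space M - F l" by blast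
    ultimately show "{x \<in> space M. x \<in> space M - F l} \<in> events" by simp
  qed
  have probF: "q ^ m \<le> prob (F l)" if l: "l \<in> L" for l
  proof -
    have "q ^ m \<le> q ^ card (K l)" using card[OF l] q by (intro power_decreasing)
    also have "\<dots> \<le> (\<Prod>i\<in>K l. prob {\<omega> \<in> space M. X i \<omega> = t i})"
      using prod_mono[of "K l" "\<lambda>_. q"] hit[OF l] q by simp
    also have "\<dots> = (\<Prod>i\<in>K l. prob (X i -` {t i} \<inter> space M))"
      by (intro prod.cong refl arg_cong[where f = prob]) auto
    also have "\<dots> = prob (\<Inter>i\<in>K l. X i -` {t i} \<inter> space M)"
      using ne[OF l] fin(2)[OF l] K(1)[OF l] by (intro indep_varsD[OF ind, symmetric]) auto
    also have "(\<Inter>i\<in>K l. X i -` {t i} \<inter> space M) = F l"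
      using ne[OF l] unfolding F_def by auto
    finally show ?thesis .
  qed
  show "prob {\<omega> \<in> space M. \<forall>l\<in>L. \<exists>i\<in>K l. X i \<omega> \<noteq> t i} \<le> (1 - q ^ m) ^ card L"
  proof (cases "L = {}")
    case True
    then show ?thesis by (simp add: prob_space)
  next
    case False
    define Y where "Y l \<omega> = restrict (\<lambda>i. X i \<omega>) (K l)" for l \<omega>
    define A where "A l = space (PiM (K l) (\<lambda>_. count_space (UNIV :: 'b set))) - PiE (K l) (\<lambda>i. {t i})" for l
    have Y: "indep_vars (\<lambda>l. PiM (K l) (\<lambda>_. count_space UNIV)) Y L"
      unfolding Y_def by (rule indep_vars_restrict[OF ind K(1) K(2)])
    have A: "A l \<in> sets (PiM (K l) (\<lambda>_. count_space UNIV))" if "l \<in> L" for l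
      unfolding A_def using fin(2)[OF that] by (intro sets.compl_sets sets_PiM_I_finite) auto
    have YA: "Y l -` A l \<inter> space M = space M - F l" for l
      unfolding Y_def A_def F_def space_PiM by (auto simp: PiE_iff)
    have "prob {\<omega> \<in> space M. \<forall>l\<in>L. \<exists>i\<in>K l. X i \<omega> \<noteq> t i} = prob (\<Inter>l\<in>L. Y l -` A l \<inter> space M)"
      unfolding miss YA using False by (intro arg_cong[where f = prob]) blast
    also have "\<dots> = (\<Prod>l\<in>L. prob (Y l -` A l \<inter> space M))"
      by (rule indep_varsD[OF Y False fin(1) subset_refl A])
    also have "\<dots> \<le> (\<Prod>l\<in>L. 1 - q ^ m)"
      using probF F by (intro prod_mono) (auto simp: YA prob_compl)
    finally show ?thesis by simp
  qed
qed

section \<open>Boundaries of random cubes\<close>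

lemma random_dyadic_systemD:
  assumes "random_dyadic_system \<delta> M Z zpar y idx rule Q'"
  shows "maximal_separated (\<delta> powi k) (Z k)" and "parent_map (1 / 2) 1 \<delta> Z zpar" and "prob_space M"
    and "p \<in> Z k \<Longrightarrow> \<omega> \<in> space M \<Longrightarrow> y k p \<omega> \<in> children Z zpar k p"
    and "p \<in> Z k \<Longrightarrow>
      distr M (count_space UNIV) (y k p) = measure_pmf (pmf_of_set (children Z zpar k p))"
    and "prob_space.indep_vars M (\<lambda>_. count_space UNIV) (\<lambda>(k, p). y k p) (SIGMA k:UNIV. Z k)"
    and "\<omega> \<in> space M \<Longrightarrow> dyadic_system \<delta> (random_centres \<delta> Z y idx \<omega>)
        (rule_parents rule (random_centres \<delta> Z y idx \<omega>)) (Q' \<omega>)"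
  using assms unfolding random_dyadic_system_def by simp_all

text \<open>The trial of generation \<open>l\<close> succeeds if the net points near \<open>x\<close> make the prescribed choices.
  Doubling bounds both the number of these net points and the number of their children, so the
  probability of success is bounded below; trials of different generations use different choices.\<close>

lemma no_near_centre_prob:
  fixes Z :: "int \<Rightarrow> 'a::metric_space set" and M :: "'w measure"
  assumes gd: "geometrically_doubling TYPE('a)" and "0 < \<delta>" and "\<delta> \<le> 1 / 1000"
    and rds: "random_dyadic_system \<delta> M Z zpar y idx rule Q'"
  obtains \<pi> where "0 < \<pi>" and "\<pi> < 1"
    and "\<And>x k n. \<exists>B\<in>sets M. emeasure M B \<le> ennreal ((1 - \<pi>) ^ n) \<and>
      (\<forall>\<omega>\<in>space M - B. \<exists>l. k \<le> l \<and> l < k + int n \<and>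
        (\<exists>p\<in>random_centres \<delta> Z y idx \<omega> l. dist x p < \<delta> powi (l + 1)))"
proof -
  note net = random_dyadic_systemD(1)[OF rds] and pm = random_dyadic_systemD(2)[OF rds]
    and ind = random_dyadic_systemD(6)[OF rds]
  interpret prob_space M by (rule random_dyadic_systemD(3)[OF rds])
  have pos: "\<And>k. 0 < \<delta> powi k" using assms(2) by simp
  have sep: "\<And>k. separated (\<delta> powi k) (Z k)"
    using net unfolding maximal_separated_def by blast
  obtain D :: nat where D: "\<And>(x::'a) R s S. \<lbrakk>0 < R; 0 < s; 2 * R \<le> (2 / \<delta>) * s; separated s S; S \<subseteq> ball x R\<rbrakk>
      \<Longrightarrow> finite S \<and> card S \<le> D"
    using doubling_separated_bound[OF gd] by blast
  have near: "finite (Z l \<inter> ball x (2 * \<delta> powi l)) \<and> card (Z l \<inter> ball x (2 * \<delta> powi l)) \<le> D" for l x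
  proof (rule D[of "2 * \<delta> powi l" "\<delta> powi l"])
    have "4 * \<delta> powi l \<le> 2 / \<delta> * \<delta> powi l"
      using assms(2,3) by (intro mult_right_mono) (auto simp: field_simps)
    then show "2 * (2 * \<delta> powi l) \<le> 2 / \<delta> * \<delta> powi l" by simp
    show "separated (\<delta> powi l) (Z l \<inter> ball x (2 * \<delta> powi l))"
      using sep unfolding separated_def by blast
  qed (use pos in auto)
  have child: "finite (children Z zpar l z) \<and> card (children Z zpar l z) \<le> D" for l z
  proof (rule D[of "\<delta> powi l" "\<delta> powi (l + 1)"])
    show "2 * \<delta> powi l \<le> 2 / \<delta> * \<delta> powi (l + 1)"
      using assms(2) by (simp add: power_int_add)
    show "separated (\<delta> powi (l + 1)) (children Z zpar l z)"
      using sep[of "l + 1"] unfolding separated_def by (simp add: children_iff)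
    show "children Z zpar l z \<subseteq> ball z (\<delta> powi l)"
    proof
      fix q assume "q \<in> children Z zpar l z"
      then show "q \<in> ball z (\<delta> powi l)"
        using parent_dist[OF pm _ assms(2), of q "l + 1"] by (simp add: children_iff dist_commute)
    qed
  qed (use pos in auto)
  \<comment> \<open>A success probability of 1 would leave no exponent \<open>\<eta>\<close> with \<open>\<delta>^\<eta> = 1 - \<pi>\<close>; adding 2 here and 1 to
    the exponent \<open>D\<close> below keeps the bound \<open>\<pi>\<close> below 1 even if all choices are forced.\<close>
  define q where "q = 1 / (real D + 2)"
  have q: "0 < q" "q < 1" unfolding q_def by simp_all
  have hit: "q \<le> prob {\<omega> \<in> space M. y l z \<omega> = u}" if z: "z \<in> Z l" and u: "u \<in> children Z zpar l z" for l z u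
  proof -
    have rv: "random_variable (count_space UNIV) (y l z)"
      using ind z unfolding indep_vars_def by fastforce
    have "prob {\<omega> \<in> space M. y l z \<omega> = u} = prob (y l z -` {u} \<inter> space M)"
      by (intro arg_cong[where f = prob]) auto
    also have "\<dots> = measure (distr M (count_space UNIV) (y l z)) {u}"
      using measure_distr[OF rv, of "{u}"] by simp
    also have "\<dots> = 1 / card (children Z zpar l z)"
      using child[of l z] u
      by (subst random_dyadic_systemD(5)[OF rds z], subst measure_pmf_single, subst pmf_of_set) auto
    finally have eq: "prob {\<omega> \<in> space M. y l z \<omega> = u} = 1 / card (children Z zpar l z)" .
    have "0 < card (children Z zpar l z)" using child[of l z] u by (auto simp: card_gt_0_iff)
    then show ?thesis unfolding eq q_def using child[of l z] by (intro divide_left_mono) auto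
  qed
  show thesis
  proof (rule that)
    show "0 < q ^ Suc D" using q by simp
    show "q ^ Suc D < 1" using q by (intro power_Suc_less_one)
    fix x :: 'a and k :: int and n :: nat
    define N where "N l = Z l \<inter> ball x (2 * \<delta> powi l)" for l
    have "\<forall>l. \<exists>t. (\<forall>z. z \<in> Z l \<longrightarrow> t z \<in> children Z zpar l z) \<and> N l \<noteq> {} \<and>
       (\<forall>c idx. (\<forall>z. z \<in> Z l \<longrightarrow> c z \<in> children Z zpar l z) \<longrightarrow> (\<forall>z. z \<in> N l \<longrightarrow> c z = t z) \<longrightarrow>
      (\<exists>p\<in>thinned idx (\<delta> powi l / 4) (c ` Z l). dist x p < \<delta> powi (l + 1)))" (is "\<forall>l. ?P l")
    proof (rule allI)
      fix l
      show "?P l"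
      proof (rule prescribed_choice_gives_near_centre[OF net pm assms(2,3), where l = l and x = x], goal_cases)
        case (1 t)
        show ?case unfolding N_def by (intro exI[of _ t] conjI allI impI 1) simp_all
      qed
    qed
    then obtain t where t: "\<And>l z. z \<in> Z l \<Longrightarrow> t l z \<in> children Z zpar l z" "\<And>l. N l \<noteq> {}"
        and near_centre: "\<And>l c idx. \<lbrakk>\<forall>z. z \<in> Z l \<longrightarrow> c z \<in> children Z zpar l z; \<forall>z. z \<in> N l \<longrightarrow> c z = t l z\<rbrakk> \<Longrightarrow>
          \<exists>p\<in>thinned idx (\<delta> powi l / 4) (c ` Z l). dist x p < \<delta> powi (l + 1)"
      by metis
    let ?X = "\<lambda>(l, z). y l z" and ?t = "\<lambda>(l, z). t l z" and ?L = "{k..<k + int n}"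
      and ?K = "\<lambda>l. {l} \<times> N l"
    define B where "B = {\<omega> \<in> space M. \<forall>l\<in>?L. \<exists>i\<in>?K l. ?X i \<omega> \<noteq> ?t i}"
    have K: "\<And>l. l \<in> ?L \<Longrightarrow> ?K l \<subseteq> (SIGMA k:UNIV. Z k)" "disjoint_family_on ?K ?L"
      by (auto simp: N_def disjoint_family_on_def)
    have fin: "\<And>l. l \<in> ?L \<Longrightarrow> finite (?K l)" and ne: "\<And>l. l \<in> ?L \<Longrightarrow> ?K l \<noteq> {}"
      and card: "\<And>l. l \<in> ?L \<Longrightarrow> card (?K l) \<le> Suc D"
      using near[of _ x] t(2) by (auto simp: N_def card_cartesian_product_singleton le_SucI)
    have prob: "\<And>l i. l \<in> ?L \<Longrightarrow> i \<in> ?K l \<Longrightarrow> q \<le> prob {\<omega> \<in> space M. ?X i \<omega> = ?t i}"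
      using hit t(1) by (auto simp: N_def)
    have q': "0 \<le> q" "q \<le> 1" using q by simp_all
    note trials = all_trials_miss[OF ind K finite_atLeastLessThan_int fin ne card q' prob,
        folded B_def]
    show "\<exists>B\<in>sets M. emeasure M B \<le> ennreal ((1 - q ^ Suc D) ^ n) \<and>
      (\<forall>\<omega>\<in>space M - B. \<exists>l. k \<le> l \<and> l < k + int n \<and>
        (\<exists>p\<in>random_centres \<delta> Z y idx \<omega> l. dist x p < \<delta> powi (l + 1)))"
    proof (intro bexI conjI ballI)
      show "B \<in> events" by (rule trials)
      show "emeasure M B \<le> ennreal ((1 - q ^ Suc D) ^ n)"
        unfolding emeasure_eq_measure using trials(2) by (intro ennreal_leI) simp
      fix \<omega> assume \<omega>: "\<omega> \<in> space M - B"
      then obtain l where l: "k \<le> l" "l < k + int n" and succ: "\<And>z. z \<in> N l \<Longrightarrow> y l z \<omega> = t l z"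
        unfolding B_def by auto
      have "\<exists>p\<in>thinned (idx l (random_points Z y \<omega> l)) (\<delta> powi l / 4) ((\<lambda>z. y l z \<omega>) ` Z l).
          dist x p < \<delta> powi (l + 1)"
        using \<omega> succ by (intro near_centre allI impI random_dyadic_systemD(4)[OF rds]) auto
      then show "\<exists>l. k \<le> l \<and> l < k + int n \<and>
          (\<exists>p\<in>random_centres \<delta> Z y idx \<omega> l. dist x p < \<delta> powi (l + 1))"
        using l unfolding random_centres_def random_points_def by blast
    qed
  qed
qed

text \<open>The exponent is the one for which failure of \<open>n\<close> trials has probability \<open>(\<delta>^n)^\<eta>\<close>. A point
  within \<open>\<epsilon> * \<delta>^k\<close> of the boundary of a cube of generation \<open>k\<close> has no close centre in any
  generation \<open>k + i\<close> with \<open>200 * \<epsilon> < \<delta>^i\<close>.\<close>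

lemma cube_boundary_prob:
  fixes Z :: "int \<Rightarrow> 'a::metric_space set" and M :: "'w measure"
  assumes "geometrically_doubling TYPE('a)" and "0 < \<delta>" and "\<delta> \<le> 1 / 1000"
    and rds: "random_dyadic_system \<delta> M Z zpar y idx rule Q'"
  obtains \<eta> G where "0 < \<eta>" and "0 \<le> G"
    and "\<And>x k \<epsilon>. 0 < \<epsilon> \<Longrightarrow> \<exists>B\<in>sets M. emeasure M B \<le> ennreal (G * \<epsilon> powr \<eta>) \<and>
      {\<omega> \<in> space M. \<exists>p\<in>random_centres \<delta> Z y idx \<omega> k. x \<in> cube_boundary \<delta> \<epsilon> (Q' \<omega>) (k, p)} \<subseteq> B"
proof -
  obtain \<pi> where \<pi>: "0 < \<pi>" "\<pi> < 1"
    and trials: "\<And>x k n. \<exists>B\<in>sets M. emeasure M B \<le> ennreal ((1 - \<pi>) ^ n) \<and>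
      (\<forall>\<omega>\<in>space M - B. \<exists>l. k \<le> l \<and> l < k + int n \<and>
        (\<exists>p\<in>random_centres \<delta> Z y idx \<omega> l. dist x p < \<delta> powi (l + 1)))"
    using no_near_centre_prob[OF assms] by blast
  define \<eta> where "\<eta> = ln (1 - \<pi>) / ln \<delta>"
  have \<delta>1: "\<delta> < 1" using assms(3) by simp
  have \<eta>: "0 < \<eta>" unfolding \<eta>_def using \<pi> assms(2) \<delta>1 by (intro divide_neg_neg) auto
  have "\<delta> powr \<eta> = 1 - \<pi>"
    unfolding \<eta>_def powr_def using \<pi> assms(2) \<delta>1 by simp
  then have fail: "(1 - \<pi>) ^ n = (\<delta> ^ n) powr \<eta>" for n
    using assms(2) by (metis powr_realpow powr_powr mult.commute powr_gt_zero)
  show thesis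
  proof (rule that)
    show "0 < \<eta>" by (rule \<eta>)
    show "0 \<le> 200 powr \<eta>" by simp
    fix x :: 'a and k :: int and \<epsilon> :: real
    assume \<epsilon>: "0 < \<epsilon>"
    define n where "n = (LEAST n. \<delta> ^ n \<le> 200 * \<epsilon>)"
    have "\<exists>n. \<delta> ^ n < 200 * \<epsilon>"
      using real_arch_pow_inv[of "200 * \<epsilon>" \<delta>] \<epsilon> \<delta>1 by simp
    then have "\<exists>n. \<delta> ^ n \<le> 200 * \<epsilon>" using less_imp_le by blast
    then have n: "\<delta> ^ n \<le> 200 * \<epsilon>" unfolding n_def by (rule LeastI_ex)
    have before: "200 * \<epsilon> < \<delta> ^ i" if "i < n" for i
      using not_less_Least[OF that[unfolded n_def]] by simp
    obtain B where B: "B \<in> sets M" "emeasure M B \<le> ennreal ((1 - \<pi>) ^ n)"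
      and near: "\<And>\<omega>. \<omega> \<in> space M - B \<Longrightarrow> \<exists>l. k \<le> l \<and> l < k + int n \<and>
        (\<exists>p\<in>random_centres \<delta> Z y idx \<omega> l. dist x p < \<delta> powi (l + 1))"
      using trials[of n k x] by blast
    have "(1 - \<pi>) ^ n \<le> (200 * \<epsilon>) powr \<eta>"
      unfolding fail using n \<eta> assms(2) by (intro powr_mono2) auto
    also have "\<dots> = 200 powr \<eta> * \<epsilon> powr \<eta>" using \<epsilon> by (simp add: powr_mult)
    finally have "emeasure M B \<le> ennreal (200 powr \<eta> * \<epsilon> powr \<eta>)"
      using B(2) ennreal_leI order_trans by blast
    moreover have "{\<omega> \<in> space M. \<exists>p\<in>random_centres \<delta> Z y idx \<omega> k. x \<in> cube_boundary \<delta> \<epsilon> (Q' \<omega>) (k, p)} \<subseteq> B"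
    proof (clarify, rule ccontr)
      fix \<omega> q assume \<omega>: "\<omega> \<in> space M" "\<omega> \<notin> B" and q: "q \<in> random_centres \<delta> Z y idx \<omega> k"
        and bd: "x \<in> cube_boundary \<delta> \<epsilon> (Q' \<omega>) (k, q)"
      obtain l p where l: "k \<le> l" "l < k + int n"
        and p: "p \<in> random_centres \<delta> Z y idx \<omega> l" "dist x p < \<delta> powi (l + 1)"
        using near[of \<omega>] \<omega> by blast
      define i where "i = nat (l - k)"
      have i: "i < n" "l = k + int i" using l by (auto simp: i_def)
      have "\<epsilon> * \<delta> powi k < \<delta> ^ i / 200 * \<delta> powi k"
        using before[OF i(1)] assms(2) by (intro mult_strict_right_mono) auto
      also have "\<dots> = \<delta> powi l / 200"
        using assms(2) by (simp add: i(2) power_int_add)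
      finally show False
        using near_centre_not_in_boundary[OF random_dyadic_systemD(7)[OF rds \<omega>(1)] assms(2,3) p l(1) q]
          bd by blast
    qed
    ultimately show "\<exists>B\<in>sets M. emeasure M B \<le> ennreal (200 powr \<eta> * \<epsilon> powr \<eta>) \<and>
      {\<omega> \<in> space M. \<exists>p\<in>random_centres \<delta> Z y idx \<omega> k. x \<in> cube_boundary \<delta> \<epsilon> (Q' \<omega>) (k, p)} \<subseteq> B"
      using B(1) by blast
  qed
qed

section \<open>Bad cubes\<close>

lemma eset_dist_less:
  assumes "\<not> ennreal s \<le> eset_dist A B" and "0 \<le> s"
  obtains a b where "a \<in> A" and "b \<in> B" and "dist a b < s"
proof -
  have "eset_dist A B < ennreal s" using assms(1) by simp
  then obtain a b where "a \<in> A" "b \<in> B" "ennreal (dist a b) < ennreal s"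
    unfolding eset_dist_def INF_less_iff by blast
  then show thesis using that assms(2) by (simp add: ennreal_less_iff)
qed

lemma eset_dist_point_le:
  assumes "A \<subseteq> cball p t" and "\<not> ennreal s \<le> eset_dist A B" and "0 \<le> s" and "t + s \<le> u"
  shows "eset_dist {p} B \<le> ennreal u"
proof -
  obtain a b where ab: "a \<in> A" "b \<in> B" "dist a b < s"
    using eset_dist_less[OF assms(2,3)] by blast
  have "eset_dist {p} B \<le> ennreal (dist p b)"
    unfolding eset_dist_def using ab(2) by (auto intro: INF_lower)
  also have "\<dots> \<le> ennreal u"
  proof (rule ennreal_leI)
    have "dist p a \<le> t" using ab(1) assms(1) by auto
    then show "dist p b \<le> u" using dist_triangle[of p b a] ab(3) assms(4) by linarith
  qed
  finally show ?thesis .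
qed

text \<open>A cube lies in the ball of radius \<open>5 * \<delta>^k\<close> about its centre, and since \<open>\<gamma> \<le> 1\<close> the side \<open>\<delta>^k\<close>
  is at most the threshold \<open>\<delta>^(k \<gamma>) * \<delta>^(l (1 - \<gamma>))\<close> of the definition of good cubes. So the
  centre of a bad cube is within six times this threshold of both sets, and the threshold equals
  \<open>\<delta>^((k - l) \<gamma>) * \<delta>^l\<close>.\<close>

lemma bad_cube_centre_in_boundary:
  assumes "dyadic_system \<delta> C par Q" and "0 < \<delta>" and "\<delta> \<le> 1 / 1000" and "0 < \<gamma>" and "\<gamma> \<le> 1"
    and bad: "(k, p) \<in> bad_cubes \<delta> \<gamma> r C' Q' C Q"
  obtains m q where "r \<le> m" and "q \<in> C' (k - int m)"
    and "p \<in> cube_boundary \<delta> (6 * \<delta> powr (real m * \<gamma>)) Q' (k - int m, q)"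
proof -
  define \<rho> where "\<rho> l = (\<delta> powi k) powr \<gamma> * (\<delta> powi l) powr (1 - \<gamma>)" for l
  have p: "p \<in> C k" using bad unfolding bad_cubes_def by simp
  obtain l q where q: "q \<in> C' l" "\<delta> powi k \<le> \<delta> ^ r * \<delta> powi l"
    and near: "\<not> ennreal (\<rho> l) \<le> eset_dist (Q k p) (Q' l q)"
      "\<not> ennreal (\<rho> l) \<le> eset_dist (Q k p) (- Q' l q)"
    using bad unfolding bad_cubes_def good_cube_def \<rho>_def by auto
  define m where "m = nat (k - l)"
  have "\<delta> ^ r * \<delta> powi l = \<delta> powi (l + int r)" using assms(2) by (simp add: power_int_add)
  then have "l + int r \<le> k"
    using q(2) power_int_strict_decreasing[of k "l + int r" \<delta>] assms(2,3) by fastforce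
  then have m: "r \<le> m" "k = l + int m" unfolding m_def by simp_all
  have pos: "0 < \<delta> powi l" using assms(2) by simp
  have k: "\<delta> powi k = \<delta> powi l * \<delta> ^ m" using assms(2) by (simp add: m(2) power_int_add)
  have "\<rho> l = (\<delta> powi l) powr (\<gamma> + (1 - \<gamma>)) * (\<delta> ^ m) powr \<gamma>"
    unfolding \<rho>_def k powr_add using pos assms(2) by (simp add: powr_mult)
  also have "(\<delta> ^ m) powr \<gamma> = \<delta> powr (real m * \<gamma>)"
    using assms(2) by (simp add: powr_powr flip: powr_realpow)
  finally have \<rho>: "\<rho> l = \<delta> powi l * \<delta> powr (real m * \<gamma>)" using pos by simp
  have "\<delta> powr real m \<le> \<delta> powr (real m * \<gamma>)"
    using assms(2-5) by (intro powr_mono') (auto simp: mult_left_le)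
  then have "\<delta> powi k \<le> \<rho> l"
    unfolding \<rho> k using assms(2) pos by (simp add: powr_realpow)
  then have sum: "5 * \<delta> powi k + \<rho> l \<le> 6 * \<delta> powr (real m * \<gamma>) * \<delta> powi l"
    using \<rho> by simp
  have "0 \<le> \<rho> l" unfolding \<rho>_def by simp
  then have "p \<in> cube_boundary \<delta> (6 * \<delta> powr (real m * \<gamma>)) Q' (l, q)"
    unfolding cube_boundary_def
    using eset_dist_point_le[OF cube_subset_cball[OF assms(1-3) p] near(1) _ sum]
      eset_dist_point_le[OF cube_subset_cball[OF assms(1-3) p] near(2) _ sum] by simp
  moreover have "l = k - int m" using m(2) by simp
  ultimately show thesis using that m(1) q(1) by blast
qed

theorem theorem10p2:
  fixes \<delta> \<gamma> \<alpha> Clam :: real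
    and C :: "int \<Rightarrow> 'a::metric_space set" and par :: "int \<Rightarrow> 'a \<Rightarrow> 'a"
    and Q :: "int \<Rightarrow> 'a \<Rightarrow> 'a set"
    and M :: "'w measure"
    and Z :: "int \<Rightarrow> 'a set" and zpar :: "int \<Rightarrow> 'a \<Rightarrow> 'a"
    and y :: "int \<Rightarrow> 'a \<Rightarrow> 'w \<Rightarrow> 'a"
    and idx :: "int \<Rightarrow> 'a set \<Rightarrow> 'a \<Rightarrow> nat"
    and rule :: "int \<Rightarrow> 'a set \<Rightarrow> 'a set \<Rightarrow> 'a \<Rightarrow> 'a"
    and Q' :: "'w \<Rightarrow> int \<Rightarrow> 'a \<Rightarrow> 'a set"
  assumes "geometrically_doubling TYPE('a)"
    and "0 < \<delta>" and "\<delta> \<le> 1 / 1000"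
    and "0 < \<alpha>" and "1 \<le> Clam" and "\<gamma> = \<alpha> / (2 * (\<alpha> + log 2 Clam))"
    and "dyadic_system \<delta> C par Q"
    and "random_dyadic_system \<delta> M Z zpar y idx rule Q'"
  shows "\<exists>\<eta>>0.
    (\<exists>G\<ge>0. \<forall>r\<ge>1. \<forall>k. \<forall>p\<in>C k.
       outer_measure_of M {\<omega> \<in> space M.
         (k, p) \<in> bad_cubes \<delta> \<gamma> r (random_centres \<delta> Z y idx \<omega>) (Q' \<omega>) C Q}
       \<le> ennreal (G * \<delta> powr (real r * \<gamma> * \<eta>))) \<and>
    (\<exists>G'\<ge>0. \<forall>x k. \<forall>\<epsilon>>0.
       outer_measure_of M {\<omega> \<in> space M.
         \<exists>p\<in>random_centres \<delta> Z y idx \<omega> k. x \<in> cube_boundary \<delta> \<epsilon> (Q' \<omega>) (k, p)}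
       \<le> ennreal (G' * \<epsilon> powr \<eta>))"
proof -
  have log: "0 \<le> log 2 Clam" using \<open>1 \<le> Clam\<close> by simp
  have \<gamma>: "0 < \<gamma>" "\<gamma> \<le> 1"
    using \<open>0 < \<alpha>\<close> log unfolding \<open>\<gamma> = _\<close> by (auto simp: field_simps)
  have \<delta>: "0 < \<delta>" "\<delta> < 1" using assms(2,3) by simp_all
  obtain \<eta> G where \<eta>: "0 < \<eta>" and G: "0 \<le> G"
    and bd: "\<And>x k \<epsilon>. 0 < \<epsilon> \<Longrightarrow> \<exists>B\<in>sets M. emeasure M B \<le> ennreal (G * \<epsilon> powr \<eta>) \<and>
      {\<omega> \<in> space M. \<exists>p\<in>random_centres \<delta> Z y idx \<omega> k. x \<in> cube_boundary \<delta> \<epsilon> (Q' \<omega>) (k, p)} \<subseteq> B"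
    using cube_boundary_prob[OF assms(1,2,3,8)] by blast
  define \<theta> where "\<theta> = \<delta> powr (\<gamma> * \<eta>)"
  have \<theta>: "0 < \<theta>" "\<theta> < 1"
    unfolding \<theta>_def using \<delta> \<gamma> \<eta> by (auto simp: powr01_less_one)
  define H where "H = G * 6 powr \<eta> / (1 - \<theta>)"
  have small_bad: "outer_measure_of M {\<omega> \<in> space M.
         (k, p) \<in> bad_cubes \<delta> \<gamma> r (random_centres \<delta> Z y idx \<omega>) (Q' \<omega>) C Q}
       \<le> ennreal (H * \<delta> powr (real r * \<gamma> * \<eta>))" for r k p
  proof -
    define \<epsilon> where "\<epsilon> i = 6 * \<delta> powr (real (r + i) * \<gamma>)" for i
    define S where "S i = {\<omega> \<in> space M. \<exists>q\<in>random_centres \<delta> Z y idx \<omega> (k - int (r + i)).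
        p \<in> cube_boundary \<delta> (\<epsilon> i) (Q' \<omega>) (k - int (r + i), q)}" for i
    have "\<exists>B. B \<in> sets M \<and> emeasure M B \<le> ennreal (G * \<epsilon> i powr \<eta>) \<and> S i \<subseteq> B" for i
    proof -
      have "0 < \<epsilon> i" unfolding \<epsilon>_def using \<delta>(1) by simp
      from bd[OF this, where x = p and k = "k - int (r + i)"] show ?thesis
        unfolding S_def by (elim bexE) blast
    qed
    then obtain B where B: "\<And>i. B i \<in> sets M" "\<And>i. emeasure M (B i) \<le> ennreal (G * \<epsilon> i powr \<eta>)"
      "\<And>i. S i \<subseteq> B i"
      by metis
    have sub: "{\<omega> \<in> space M. (k, p) \<in> bad_cubes \<delta> \<gamma> r (random_centres \<delta> Z y idx \<omega>) (Q' \<omega>) C Q}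
      \<subseteq> (\<Union>i. B i)"
    proof clarify
      fix \<omega> assume \<omega>: "\<omega> \<in> space M"
        "(k, p) \<in> bad_cubes \<delta> \<gamma> r (random_centres \<delta> Z y idx \<omega>) (Q' \<omega>) C Q"
      obtain m q where m: "r \<le> m" "q \<in> random_centres \<delta> Z y idx \<omega> (k - int m)"
        "p \<in> cube_boundary \<delta> (6 * \<delta> powr (real m * \<gamma>)) (Q' \<omega>) (k - int m, q)"
        using bad_cube_centre_in_boundary[OF assms(7,2,3) \<gamma> \<omega>(2)] by blast
      obtain i where "m = r + i" using m(1) le_Suc_ex by blast
      then have "\<omega> \<in> S i" using m \<omega>(1) unfolding S_def \<epsilon>_def by blast
      then have "\<omega> \<in> B i" using B(3) by blast
      then show "\<omega> \<in> (\<Union>i. B i)" by blast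
    qed
    \<comment> \<open>The common ratio \<open>\<theta>\<close> does not depend on \<open>r\<close>, so neither does the constant \<open>H\<close>.\<close>
    have summand: "G * \<epsilon> i powr \<eta> = G * 6 powr \<eta> * \<delta> powr (real r * \<gamma> * \<eta>) * \<theta> ^ i" for i
    proof -
      have "\<epsilon> i powr \<eta> = 6 powr \<eta> * \<delta> powr (real (r + i) * \<gamma> * \<eta>)"
        unfolding \<epsilon>_def by (simp add: powr_mult powr_powr)
      also have "real (r + i) * \<gamma> * \<eta> = real r * \<gamma> * \<eta> + (\<gamma> * \<eta>) * real i"
        by (simp add: algebra_simps)
      also have "\<delta> powr \<dots> = \<delta> powr (real r * \<gamma> * \<eta>) * \<theta> ^ i"
        unfolding \<theta>_def powr_add powr_powr[symmetric] using \<delta>(1) by (simp add: powr_realpow)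
      finally show ?thesis by simp
    qed
    have "outer_measure_of M {\<omega> \<in> space M.
         (k, p) \<in> bad_cubes \<delta> \<gamma> r (random_centres \<delta> Z y idx \<omega>) (Q' \<omega>) C Q} \<le> emeasure M (\<Union>i. B i)"
      unfolding outer_measure_of_def using sub B(1) by (intro INF_lower) auto
    also have "\<dots> \<le> (\<Sum>i. emeasure M (B i))"
      using B(1) by (intro emeasure_subadditive_countably) auto
    also have "\<dots> \<le> (\<Sum>i. ennreal (G * \<epsilon> i powr \<eta>))"
      using B(2) by (intro suminf_le) auto
    also have "\<dots> = ennreal (G * 6 powr \<eta> * \<delta> powr (real r * \<gamma> * \<eta>) * (1 / (1 - \<theta>)))"
      unfolding summand using \<theta> G
      by (intro suminf_ennreal_eq sums_mult geometric_sums) auto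
    also have "G * 6 powr \<eta> * \<delta> powr (real r * \<gamma> * \<eta>) * (1 / (1 - \<theta>)) = H * \<delta> powr (real r * \<gamma> * \<eta>)"
      unfolding H_def by simp
    finally show ?thesis .
  qed
  have "0 \<le> H" unfolding H_def using G \<theta> by simp
  moreover have "outer_measure_of M {\<omega> \<in> space M.
      \<exists>p\<in>random_centres \<delta> Z y idx \<omega> k. x \<in> cube_boundary \<delta> \<epsilon> (Q' \<omega>) (k, p)}
    \<le> ennreal (G * \<epsilon> powr \<eta>)" if \<epsilon>: "0 < \<epsilon>" for x k \<epsilon>
  proof -
    obtain B where B: "B \<in> sets M" "emeasure M B \<le> ennreal (G * \<epsilon> powr \<eta>)"
      "{\<omega> \<in> space M. \<exists>p\<in>random_centres \<delta> Z y idx \<omega> k. x \<in> cube_boundary \<delta> \<epsilon> (Q' \<omega>) (k, p)} \<subseteq> B"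
      using bd[OF \<epsilon>, of k x] by blast
    have "outer_measure_of M {\<omega> \<in> space M.
        \<exists>p\<in>random_centres \<delta> Z y idx \<omega> k. x \<in> cube_boundary \<delta> \<epsilon> (Q' \<omega>) (k, p)} \<le> emeasure M B"
      unfolding outer_measure_of_def using B by (intro INF_lower) auto
    then show ?thesis using B(2) by (rule order_trans)
  qed
  ultimately show ?thesis
    using \<eta> G small_bad by (intro exI[of _ \<eta>] conjI exI[of _ H] exI[of _ G]) blast+
qed

end
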